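(* Let $f\colon\mathbb F_2^n\to\{+1,-1\}$, let $1\le d\le n$, let $\epsilon_1=\epsilon_d(f)$, and let $\delta=\Delta_d(f)/4$. Then: (1) $D^{\rightarrow,U}_{(1-\epsilon_1)/2}(f^+)\le D^{lin,U}_{(1-\epsilon_1)/2}(f)\le d$; (2) for every $\gamma<\frac{1-\sqrt{\epsilon_1}}{2}$, $D^{lin,U}_{\gamma}(f)\ge d+1$; (3) $D^{\rightarrow,U}_{\delta}(f^+)\ge d$.
   Context: Fourier analysis: for $f\colon\mathbb F_2^n\to\mathbb R$ and $S\in\mathbb F_2^n$, $\hat f(S)=\mathbb E_{x\sim U(\mathbb F_2^n)}[f(x)(-1)^{S\cdot x}]$, where $S\cdot x=\sum_iS_ix_i$ over $\mathbb F_2$. For $0\le d\le n$, $\epsilon_d(f)$ denotes the maximum, over all linear subspaces $A\le\mathbb F_2^n$ of dimension $d$, of $\sum_{S\in A}\hat f(S)^2$ (the paper defines $\epsilon_d(f)$ as the largest $\epsilon$ with $\dim_\epsilon(f)=d$, where $\dim_\epsilon(f)$ is the least dimension of a linear subspace $A$ with $\sum_{S\in A}\hat f(S)^2\ge\epsilon$). The approximate Fourier dimension gap is $\Delta_d(f)=\epsilon_d(f)-\epsilon_{d-1}(f)$. $f^+(x,y)=f(x+y)$. $D^{lin,U}_\delta(f)$ is the smallest $k$ such that there are fixed $\alpha_1,\dots,\alpha_k\in\mathbb F_2^n$ and $g\colon\mathbb F_2^k\to\{+1,-1\}$ with $\Pr_{x\sim U(\mathbb F_2^n)}[g(\alpha_1\cdot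 x,\dots,\alpha_k\cdot x)=f(x)]\ge1-\delta$. For $F\colon\mathbb F_2^n\times\mathbb F_2^n\to\{+1,-1\}$, $D^{\rightarrow,U}_\delta(F)$ is the smallest $t$ such that there are $M\colon\mathbb F_2^n\to\{0,1\}^t$ and $h\colon\{0,1\}^t\times\mathbb F_2^n\to\{+1,-1\}$ with $\Pr_{x,y}[h(M(x),y)=F(x,y)]\ge1-\delta$ for $x,y$ independent uniform over $\mathbb F_2^n$.
   Formalization: Part (3) is stated only when some ε has dim_ε(f)=d, equivalently Δ_d(f)>0; without this it is false (f constant, d=1: δ=0 and D^→_0(f^+)=0), and it fails in every excluded case. *)

theory Defs
  imports "HOL-Probability.Probability" "HOL-Library.Z2"
begin

instance bit :: finite
proof
  have "(UNIV :: bit set) = {0, 1}"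
    using bit_not_zero_iff by auto
  then show "finite (UNIV :: bit set)"
    by (metis finite.emptyI finite.insertI)
qed

definition dotp :: "bit ^ 'n \<Rightarrow> bit ^ 'n \<Rightarrow> bit" where
  "dotp S x = (\<Sum>i\<in>UNIV. S $ i * x $ i)"

definition fourier :: "(bit ^ 'n \<Rightarrow> real) \<Rightarrow> bit ^ 'n \<Rightarrow> real" where
  "fourier f S =
     measure_pmf.expectation (pmf_of_set UNIV) (\<lambda>x. f x * (-1) ^ of_bit (dotp S x))"

definition fourier_weight :: "(bit ^ 'n \<Rightarrow> real) \<Rightarrow> (bit ^ 'n) set \<Rightarrow> real" where
  "fourier_weight f A = (\<Sum>S\<in>A. (fourier f S)\<^sup>2)"

text \<open>
  The number \<open>\<epsilon>\<^sub>d(f)\<close>; the maximum is meaningful for \<open>d \<le> CARD('n)\<close>, where subspaces of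
  dimension \<open>d\<close> exist.
\<close>
definition eps_dim :: "nat \<Rightarrow> (bit ^ 'n \<Rightarrow> real) \<Rightarrow> real" where
  "eps_dim d f = Max {fourier_weight f A |A. vec.subspace A \<and> vec.dim A = d}"

definition dim_gap :: "nat \<Rightarrow> (bit ^ 'n \<Rightarrow> real) \<Rightarrow> real" where
  "dim_gap d f = eps_dim d f - eps_dim (d - 1) f"

text \<open>
  The approximate Fourier dimension \<open>dim\<^sub>\<epsilon>(f)\<close>. Here and in the complexity measures below, the
  smallest element of an empty set of candidates is \<open>\<infinity>\<close>.
\<close>
definition approx_dim :: "real \<Rightarrow> (bit ^ 'n \<Rightarrow> real) \<Rightarrow> enat" where
  "approx_dim \<epsilon> f =
     Inf {enat (vec.dim A) |A. vec.subspace A \<and> fourier_weight f A \<ge> \<epsilon>}"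

definition plus_fun :: "(bit ^ 'n \<Rightarrow> real) \<Rightarrow> bit ^ 'n \<Rightarrow> bit ^ 'n \<Rightarrow> real" where
  "plus_fun f x y = f (x + y)"

text \<open>
  \<open>D\<^sup>l\<^sup>i\<^sup>n\<^sup>,\<^sup>U\<^sub>\<delta>(f)\<close>: elements of \<open>\<bbbF>\<^sub>2\<^sup>k\<close> are bit lists of length \<open>k\<close>.
\<close>
definition D_lin :: "real \<Rightarrow> (bit ^ 'n \<Rightarrow> real) \<Rightarrow> enat" where
  "D_lin \<delta> f = Inf {enat k |k. \<exists>(\<alpha> :: (bit ^ 'n) list) (g :: bit list \<Rightarrow> real).
     length \<alpha> = k \<and> (\<forall>z. length z = k \<longrightarrow> g z \<in> {1, -1}) \<and>
     measure_pmf.prob (pmf_of_set UNIV) {x. g (map (\<lambda>a. dotp a x) \<alpha>) = f x} \<ge> 1 - \<delta>}"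

text \<open>
  \<open>D\<^sup>\<rightarrow>\<^sup>,\<^sup>U\<^sub>\<delta>(F)\<close>: messages in \<open>{0,1}\<^sup>t\<close> are Boolean lists of length \<open>t\<close>; the uniform
  distribution on all pairs \<open>(x, y)\<close> makes \<open>x\<close> and \<open>y\<close> independent and uniform.
\<close>
definition D_oneway :: "real \<Rightarrow> (bit ^ 'n \<Rightarrow> bit ^ 'n \<Rightarrow> real) \<Rightarrow> enat" where
  "D_oneway \<delta> F = Inf {enat t |t.
     \<exists>(M :: bit ^ 'n \<Rightarrow> bool list) (h :: bool list \<Rightarrow> bit ^ 'n \<Rightarrow> real).
     (\<forall>x. length (M x) = t) \<and> (\<forall>m y. length m = t \<longrightarrow> h m y \<in> {1, -1}) \<and>
     measure_pmf.prob (pmf_of_set UNIV) {(x, y). h (M x) y = F x y} \<ge> 1 - \<delta>}"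

lemma fourier_weight_mono: "A \<subseteq> B \<Longrightarrow> fourier_weight f A \<le> fourier_weight f B"
  unfolding fourier_weight_def by (rule sum_mono2) auto

lemma subspace_extend:
  fixes A :: "(bit ^ 'n) set"
  assumes "vec.subspace A" "vec.dim A \<le> m" "m \<le> CARD('n)"
  shows "\<exists>B. A \<subseteq> B \<and> vec.subspace B \<and> vec.dim B = m"
  using assms(2,3)
proof (induction m rule: dec_induct)
  case base
  then show ?case using assms by blast
next
  case (step m)
  then obtain B where B: "A \<subseteq> B" "vec.subspace B" "vec.dim B = m" by auto
  then have "vec.span B \<noteq> UNIV"
    using step vec.dim_eq_full[of B] vec_dim_card[where 'a = bit and 'n = 'n]
    by (metis Suc_n_not_le_n vec.dim_span)
  then obtain v where "v \<notin> vec.span B" by blast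
  then have "vec.dim (vec.span (insert v B)) = Suc m"
    using B vec.dim_insert[of v B] by simp
  then show ?case
    using B vec.subspace_span[of "insert v B"] vec.span_superset[of "insert v B"] by blast
qed

lemma finite_weights:
  "finite {fourier_weight f A |A. vec.subspace A \<and> vec.dim A = d}"
  by simp

lemma fourier_weight_le_eps_dim:
  "vec.subspace A \<Longrightarrow> vec.dim A = d \<Longrightarrow> fourier_weight f A \<le> eps_dim d f"
  unfolding eps_dim_def by (rule Max_ge[OF finite_weights]) blast

lemma eps_dim_attained:
  fixes f :: "bit ^ 'n \<Rightarrow> real"
  assumes "d \<le> CARD('n)"
  obtains A where "vec.subspace A" "vec.dim A = d" "fourier_weight f A = eps_dim d f"
proof -
  obtain B :: "(bit ^ 'n) set" where "vec.subspace B" "vec.dim B = d"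
    using subspace_extend[of "{0}" d] assms by (auto simp: vec.subspace_0)
  then have "{fourier_weight f A |A. vec.subspace A \<and> vec.dim A = d} \<noteq> {}" by blast
  from Max_in[OF finite_weights this] that show ?thesis
    unfolding eps_dim_def by auto
qed

lemma approx_dim_eq_iff:
  fixes f :: "bit ^ 'n \<Rightarrow> real"
  assumes "1 \<le> d" "d \<le> CARD('n)"
  shows "approx_dim \<epsilon> f = enat d \<longleftrightarrow> eps_dim (d - 1) f < \<epsilon> \<and> \<epsilon> \<le> eps_dim d f"
proof -
  have le_iff: "approx_dim \<epsilon> f \<le> enat k \<longleftrightarrow> \<epsilon> \<le> eps_dim k f" if k: "k \<le> CARD('n)" for k
  proof
    let ?D = "{enat (vec.dim A) |A. vec.subspace A \<and> fourier_weight f A \<ge> \<epsilon>}"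
    assume le: "approx_dim \<epsilon> f \<le> enat k"
    then have "?D \<noteq> {}"
      unfolding approx_dim_def by (metis (lifting) Inf_empty infinity_ileE top_enat_def)
    then have "Inf ?D \<in> ?D" by (metis (lifting) Inf_enat_def LeastI ex_in_conv)
    then obtain A where A: "vec.subspace A" "fourier_weight f A \<ge> \<epsilon>" "vec.dim A \<le> k"
      using le unfolding approx_dim_def by auto
    then obtain B where "A \<subseteq> B" "vec.subspace B" "vec.dim B = k"
      using subspace_extend[OF A(1,3) k] by auto
    then show "\<epsilon> \<le> eps_dim k f"
      using A(2) fourier_weight_mono[of A B f] fourier_weight_le_eps_dim[of B k f] by linarith
  next
    assume "\<epsilon> \<le> eps_dim k f"
    moreover obtain A where "vec.subspace A" "vec.dim A = k" "fourier_weight f A = eps_dim k f"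
      by (rule eps_dim_attained[OF k])
    ultimately show "approx_dim \<epsilon> f \<le> enat k"
      unfolding approx_dim_def by (intro Inf_lower) auto
  qed
  have "approx_dim \<epsilon> f = enat d \<longleftrightarrow>
      approx_dim \<epsilon> f \<le> enat d \<and> \<not> approx_dim \<epsilon> f \<le> enat (d - 1)"
    using assms by (cases "approx_dim \<epsilon> f") auto
  then show ?thesis using le_iff[of d] le_iff[of "d - 1"] assms by auto
qed

text \<open>
  Agreement with the definition of \<open>\<epsilon>\<^sub>d(f)\<close> as the largest \<open>\<epsilon>\<close> with \<open>dim\<^sub>\<epsilon>(f) = d\<close>: such an
  \<open>\<epsilon>\<close> exists iff the gap is positive, and then the largest one is \<^term>\<open>eps_dim d f\<close>.
  It fails to exist exactly when \<open>\<epsilon>\<^sub>d\<^sub>-\<^sub>1(f) = 1\<close> already (for \<open>f\<close> with values \<open>\<plusminus>1\<close>), for instance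
  for constant \<open>f\<close>; then the gap is \<open>0\<close> and \<open>d - 1\<close> bits suffice to compute \<open>f\<^sup>+\<close> exactly, so a
  lower bound \<open>d\<close> at error \<open>\<Delta>\<^sub>d(f)/4\<close> needs \<open>\<epsilon>\<^sub>d(f)\<close> to be defined in this sense.
\<close>
lemma approx_dim_exists_iff:
  fixes f :: "bit ^ 'n \<Rightarrow> real"
  assumes "1 \<le> d" "d \<le> CARD('n)"
  shows "(\<exists>\<epsilon>. approx_dim \<epsilon> f = enat d) \<longleftrightarrow> 0 < dim_gap d f"
  unfolding approx_dim_eq_iff[OF assms] dim_gap_def by force

lemma eps_dim_greatest:
  fixes f :: "bit ^ 'n \<Rightarrow> real"
  assumes "1 \<le> d" "d \<le> CARD('n)" "\<exists>\<epsilon>. approx_dim \<epsilon> f = enat d"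
  shows "approx_dim (eps_dim d f) f = enat d"
    and "approx_dim \<epsilon> f = enat d \<Longrightarrow> \<epsilon> \<le> eps_dim d f"
  using assms(3) unfolding approx_dim_eq_iff[OF assms(1,2)] by auto

end

theory Submission
  imports Defs
begin

text \<open>
  For a subspace \<open>A\<close> with orthogonal complement \<open>P\<close>, averaging \<open>f\<close> over the cosets of \<open>P\<close> keeps
  exactly the Fourier coefficients in \<open>A\<close>, so the average \<open>F\<close> satisfies \<open>E[F\<^sup>2] = fourier_weight f A\<close>.
  The parities in \<open>A\<close> determine the coset of \<open>x\<close>. Hence the sign of \<open>F\<close> is the best linear sketch
  based on \<open>A\<close>: its advantage is \<open>E \<bar>F\<bar>\<close>, and \<open>E[F\<^sup>2] \<le> E \<bar>F\<bar> \<le> sqrt (E[F\<^sup>2])\<close>.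

  For the one-way lower bound take \<open>A\<close> of dimension \<open>d\<close> attaining \<open>\<epsilon>\<^sub>d(f)\<close>. By the autocorrelation
  formula, \<open>f(x + \<cdot>)\<close> and \<open>f(x' + \<cdot>)\<close> differ on a fraction of points equal to the Fourier weight of
  \<open>{S. S \<cdot> (x + x') = 1}\<close>. If \<open>x + x' \<notin> P\<close>, this is at least \<open>\<Delta>\<^sub>d(f)\<close>, because
  \<open>{S \<in> A. S \<cdot> (x + x') = 0}\<close> has dimension \<open>d - 1\<close>. So two inputs with the same message in different
  cosets of \<open>P\<close> have errors adding up to at least \<open>\<Delta>\<^sub>d(f)\<close>. There are \<open>2\<^sup>d\<close> cosets and at most
  \<open>2\<^sup>d\<^sup>-\<^sup>1\<close> messages; summing over all pairs with equal messages gives average error at least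
  \<open>\<Delta>\<^sub>d(f)/4\<close>, and the pairs \<open>(x, x)\<close>, which that count leaves out, make the inequality strict.
\<close>

text \<open>Sums and products of bits stay in ring form, so that distributivity applies, and
  \<open>CARD(bit ^ 'n)\<close> stays an atom.\<close>

declare add_bit_eq_xor [simp del] mult_bit_eq_and [simp del] CARD_vec [simp del]

section \<open>Characters and orthogonal complements\<close>

lemma bit_add_self: "(a :: bit) + a = 0"
  by (cases a) (auto simp: add_bit_eq_xor)

lemma bit_vec_add_self [simp]: "(x :: bit ^ 'n) + x = 0"
  by (simp add: vec_eq_iff bit_add_self)

lemma bit_vec_add_cancel [simp]: "(x :: bit ^ 'n) + (x + y) = y"
  by (simp add: add.assoc[symmetric])

lemma bit_vec_diff: "(x :: bit ^ 'n) - y = x + y"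
  by (simp add: diff_eq_eq add.assoc)

lemma bit_vec_add_eq_0: "(x :: bit ^ 'n) + y = 0 \<longleftrightarrow> x = y"
  by (metis bit_vec_diff right_minus_eq)

lemma sum_bit_vec_shift:
  fixes g :: "bit ^ 'n \<Rightarrow> 'a :: comm_monoid_add"
  shows "(\<Sum>x\<in>UNIV. g (x + a)) = (\<Sum>x\<in>UNIV. g x)"
  by (rule sum.reindex_bij_witness[where i = "\<lambda>x. x + a" and j = "\<lambda>x. x + a"])
    (auto simp: add.assoc)

lemma sum_subspace_shift:
  fixes A :: "(bit ^ 'n) set" and g :: "bit ^ 'n \<Rightarrow> 'a :: comm_monoid_add"
  assumes "vec.subspace A" "a \<in> A"
  shows "(\<Sum>x\<in>A. g (x + a)) = (\<Sum>x\<in>A. g x)"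
  by (rule sum.reindex_bij_witness[where i = "\<lambda>x. x + a" and j = "\<lambda>x. x + a"])
    (use assms in \<open>auto simp: add.assoc intro: vec.subspace_add\<close>)

section \<open>Bilinearity of the dot product and characters\<close>

lemma dotp_commute: "dotp S x = dotp x S"
  by (simp add: dotp_def mult.commute)

lemma dotp_add_right: "dotp S (x + y) = dotp S x + dotp S y"
  by (simp add: dotp_def distrib_left sum.distrib)

lemma dotp_add_left: "dotp (S + T) x = dotp S x + dotp T x"
  by (simp add: dotp_def distrib_right sum.distrib)

lemma dotp_scale_left: "dotp (c *s S) x = c * dotp S x"
  by (simp add: dotp_def sum_distrib_left mult.assoc)

lemma dotp_zero_left [simp]: "dotp 0 x = 0"
  by (simp add: dotp_def)

lemma dotp_scale_right: "dotp S (c *s x) = c * dotp S x"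
  by (metis dotp_commute dotp_scale_left)

lemma dotp_zero_right [simp]: "dotp S 0 = 0"
  by (simp add: dotp_def)

lemma dotp_axis: "dotp (axis i 1) x = x $ i"
proof -
  have "dotp (axis i 1) x = (\<Sum>j\<in>UNIV. if j = i then x $ i else 0)"
    unfolding dotp_def axis_def by (rule sum.cong) auto
  then show ?thesis by simp
qed

text \<open>The character with exponent \<open>dotp S x\<close>; as a case distinction, its
  multiplicativity is a check over two bits.\<close>

definition chi :: "bit ^ 'n \<Rightarrow> bit ^ 'n \<Rightarrow> real" where
  "chi S x = (if dotp S x = 0 then 1 else -1)"

lemma chi_commute: "chi S x = chi x S"
  by (simp add: chi_def dotp_commute)

lemma chi_add_right: "chi S (x + y) = chi S x * chi S y"
  by (cases "dotp S x"; cases "dotp S y") (auto simp: chi_def dotp_add_right bit_add_self)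

lemma chi_add_left: "chi (S + T) x = chi S x * chi T x"
  by (metis chi_add_right chi_commute)

lemma fourier_eq_sum:
  fixes f :: "bit ^ 'n \<Rightarrow> real"
  shows "fourier f S = (\<Sum>x\<in>UNIV. f x * chi S x) / CARD(bit ^ 'n)"
proof -
  have "(-1) ^ of_bit (dotp S x) = chi S x" for x :: "bit ^ 'n"
    by (cases "dotp S x") (auto simp: chi_def)
  then show ?thesis
    by (simp add: fourier_def integral_pmf_of_set)
qed

section \<open>Orthogonal complements, character sums and duality\<close>

definition perp :: "(bit ^ 'n) set \<Rightarrow> (bit ^ 'n) set" where
  "perp A = {x. \<forall>S\<in>A. dotp S x = 0}"

lemma subspace_perp: "vec.subspace (perp A)"
  unfolding perp_def vec.subspace_def
  by (simp add: dotp_add_right dotp_scale_right)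

lemma perp_span: "perp (vec.span A) = perp A"
proof
  show "perp (vec.span A) \<subseteq> perp A"
    by (auto simp: perp_def vec.span_base)
  show "perp A \<subseteq> perp (vec.span A)"
  proof
    fix x assume x: "x \<in> perp A"
    have "dotp S x = 0" if "S \<in> vec.span A" for S
      using that by (induction rule: vec.span_induct_alt)
        (use x in \<open>auto simp: perp_def dotp_add_left dotp_scale_left\<close>)
    then show "x \<in> perp (vec.span A)" by (simp add: perp_def)
  qed
qed

text \<open>If some \<open>T\<close> in \<open>A\<close> has \<open>chi T u = -1\<close>,
  translating the summation by \<open>T\<close> negates the sum, which therefore vanishes.\<close>

lemma sum_chi_subspace:
  fixes A :: "(bit ^ 'n) set"
  assumes "vec.subspace A"
  shows "(\<Sum>S\<in>A. chi S u) = (if u \<in> perp A then real (card A) else 0)"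
proof (cases "u \<in> perp A")
  case True
  then show ?thesis by (simp add: perp_def chi_def)
next
  case False
  then obtain T where T: "T \<in> A" "chi T u = -1"
    by (auto simp: perp_def chi_def)
  have "(\<Sum>S\<in>A. chi S u) = (\<Sum>S\<in>A. chi (S + T) u)"
    using sum_subspace_shift[OF assms T(1), of "\<lambda>S. chi S u"] by simp
  also have "\<dots> = - (\<Sum>S\<in>A. chi S u)"
    by (simp add: chi_add_left T sum_negf)
  finally show ?thesis using False by simp
qed

lemma perp_UNIV: "perp UNIV = {0 :: bit ^ 'n}"
proof -
  have "x = 0" if "x \<in> perp UNIV" for x :: "bit ^ 'n"
    using that dotp_axis[of _ x] by (auto simp: perp_def vec_eq_iff)
  then show ?thesis by (auto simp: perp_def)
qed

lemma sum_chi_UNIV: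
  "(\<Sum>S\<in>UNIV. chi S (u :: bit ^ 'n)) = (if u = 0 then real CARD(bit ^ 'n) else 0)"
  using sum_chi_subspace[OF vec.subspace_UNIV, of u] by (simp add: perp_UNIV)

text \<open>Double counting of \<open>chi S u\<close> over \<open>S\<close> in \<open>A\<close> and
  all \<open>u\<close>: summing over \<open>S\<close> first leaves only \<open>u\<close> in
  \<open>perp A\<close>, summing over \<open>u\<close> first leaves only
  \<open>S = 0\<close>.\<close>

lemma card_mult_card_perp:
  fixes A :: "(bit ^ 'n) set"
  assumes "vec.subspace A"
  shows "card A * card (perp A) = CARD(bit ^ 'n)"
proof -
  have "(\<Sum>u\<in>UNIV. \<Sum>S\<in>A. chi S u) = real (card A * card (perp A))"
    by (simp add: sum_chi_subspace[OF assms] sum.If_cases)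
  moreover have "(\<Sum>u\<in>UNIV. \<Sum>S\<in>A. chi S u) = (\<Sum>S\<in>A. \<Sum>u\<in>UNIV. chi u S)"
    by (subst sum.swap) (simp add: chi_commute)
  moreover have "\<dots> = real CARD(bit ^ 'n)"
    using vec.subspace_0[OF assms] by (simp add: sum_chi_UNIV)
  ultimately show ?thesis by linarith
qed

text \<open>One inclusion is immediate; the product formula for \<open>A\<close> and for
  \<open>perp A\<close> shows that both sides have the same size.\<close>

lemma perp_perp:
  fixes A :: "(bit ^ 'n) set"
  assumes "vec.subspace A"
  shows "perp (perp A) = A"
proof -
  have "card A * card (perp A) = card (perp (perp A)) * card (perp A)"
    by (metis assms card_mult_card_perp mult.commute subspace_perp)
  moreover have "card (perp A) > 0"
    using vec.subspace_0[OF subspace_perp[of A]] by (auto simp: card_gt_0_iff)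
  ultimately have "card A = card (perp (perp A))" by (metis mult_right_cancel less_irrefl)
  moreover have "A \<subseteq> perp (perp A)"
    by (auto simp: perp_def dotp_commute)
  ultimately show ?thesis
    by (metis card_subset_eq finite)
qed

text \<open>The only scalars are 0 and 1, so a new basis vector \<open>v\<close> adds exactly the
  disjoint coset \<open>v + span B\<close> and doubles the span.\<close>

lemma card_subspace:
  fixes A :: "(bit ^ 'n) set"
  assumes "vec.subspace A"
  shows "card A = 2 ^ vec.dim A"
proof -
  have indep: "vec.independent B \<Longrightarrow> card (vec.span B) = 2 ^ card B" for B :: "(bit ^ 'n) set"
  proof (induction B rule: infinite_finite_induct)
    case (insert v B)
    then have v: "v \<notin> vec.span B" and B: "vec.independent B"
      by (auto simp: vec.independent_insert)
    have span: "vec.span (insert v B) = vec.span B \<union> (+) v ` vec.span B"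
    proof (intro equalityI subsetI)
      fix x assume "x \<in> vec.span (insert v B)"
      then obtain k where k: "x - k *s v \<in> vec.span B"
        by (auto simp: vec.span_breakdown_eq)
      show "x \<in> vec.span B \<union> (+) v ` vec.span B"
      proof (cases k)
        case zero
        then show ?thesis using k by simp
      next
        case one
        then have "v + (v + x) \<in> (+) v ` vec.span B"
          using k by (intro imageI) (simp add: bit_vec_diff add.commute)
        then show ?thesis by simp
      qed
    next
      fix x assume "x \<in> vec.span B \<union> (+) v ` vec.span B"
      then show "x \<in> vec.span (insert v B)"
        by (auto intro: vec.span_add vec.span_base vec.span_mono[THEN subsetD, of B])
    qed
    have "vec.span B \<inter> (+) v ` vec.span B = {}"
      using v vec.span_diff by fastforce
    then have "card (vec.span (insert v B)) = 2 * card (vec.span B)"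
      unfolding span by (subst card_Un_disjoint) (auto simp: card_image)
    then show ?case using insert B by simp
  qed auto
  obtain B where "B \<subseteq> A" "vec.independent B" "A \<subseteq> vec.span B" "card B = vec.dim A"
    by (rule vec.basis_exists)
  then show ?thesis
    using indep[of B] vec.span_minimal[OF _ assms, of B] by (metis subset_antisym)
qed

text \<open>Some \<open>T\<close> in \<open>A\<close> has \<open>dotp T u = 1\<close>. Subtracting
  \<open>dotp S u\<close> times \<open>T\<close> moves any \<open>S\<close> in \<open>A\<close> into
  the section, so \<open>T\<close> is the only missing generator.\<close>

lemma dim_hyperplane_section:
  fixes A :: "(bit ^ 'n) set"
  assumes A: "vec.subspace A" and u: "u \<notin> perp A"
  shows "vec.subspace {S \<in> A. dotp S u = 0}"
    and "vec.dim {S \<in> A. dotp S u = 0} = vec.dim A - 1"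
proof -
  let ?H = "{S \<in> A. dotp S u = 0}"
  show H: "vec.subspace ?H"
    using A unfolding vec.subspace_def by (auto simp: dotp_add_left dotp_scale_left)
  obtain T where T: "T \<in> A" "dotp T u = 1"
    using u by (auto simp: perp_def)
  have span: "vec.span (insert T ?H) = A"
  proof
    show "vec.span (insert T ?H) \<subseteq> A"
      using T by (intro vec.span_minimal[OF _ A]) auto
    show "A \<subseteq> vec.span (insert T ?H)"
    proof
      fix S assume S: "S \<in> A"
      have "S - dotp S u *s T \<in> ?H"
        using S T A by (cases "dotp S u")
          (auto simp: bit_vec_diff dotp_add_left bit_add_self intro: vec.subspace_add)
      then have "S - dotp S u *s T \<in> vec.span ?H" by (rule vec.span_base)
      then show "S \<in> vec.span (insert T ?H)" by (auto simp: vec.span_breakdown_eq)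
    qed
  qed
  have "T \<notin> vec.span ?H"
    using T H by (simp add: vec.span_eq_iff[THEN iffD2])
  then have "vec.dim A = vec.dim ?H + 1"
    using vec.dim_insert[of T ?H] vec.dim_span[of "insert T ?H"] span by simp
  then show "vec.dim ?H = vec.dim A - 1" by simp
qed

section \<open>Autocorrelation and averaging over cosets\<close>

lemma chi_zero_right [simp]: "chi S 0 = 1"
  by (simp add: chi_def)

text \<open>Expanding the squared coefficients gives a sum over \<open>x\<close>, \<open>y\<close>
  and \<open>S\<close>; summing the characters over \<open>S\<close> first forces
  \<open>y = x + u\<close>. The case \<open>u = 0\<close> is Parseval's identity.\<close>

lemma autocorrelation:
  fixes f :: "bit ^ 'n \<Rightarrow> real"
  shows "(\<Sum>x\<in>UNIV. f x * f (x + u)) = CARD(bit ^ 'n) * (\<Sum>S\<in>UNIV. (fourier f S)\<^sup>2 * chi S u)"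
proof -
  let ?N = "real CARD(bit ^ 'n)"
  have term_eq: "(fourier f S)\<^sup>2 * chi S u =
      (\<Sum>x\<in>UNIV. \<Sum>y\<in>UNIV. f x * f y * chi S (x + y + u)) / ?N\<^sup>2" for S
    by (simp add: fourier_eq_sum power_divide power2_eq_square[of "sum _ _"] sum_product
        sum_distrib_left sum_distrib_right chi_add_right algebra_simps)
  have "(\<Sum>S\<in>UNIV. (fourier f S)\<^sup>2 * chi S u) =
      (\<Sum>S\<in>UNIV. \<Sum>x\<in>UNIV. \<Sum>y\<in>UNIV. f x * f y * chi S (x + y + u)) / ?N\<^sup>2"
    by (simp only: term_eq sum_divide_distrib)
  also have "(\<Sum>S\<in>UNIV. \<Sum>x\<in>UNIV. \<Sum>y\<in>UNIV. f x * f y * chi S (x + y + u)) =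
      (\<Sum>x\<in>UNIV. \<Sum>y\<in>UNIV. f x * f y * (\<Sum>S\<in>UNIV. chi S (x + y + u)))"
    unfolding sum_distrib_left
    by (subst sum.swap, rule sum.cong[OF refl], rule sum.swap)
  also have "\<dots> = (\<Sum>x\<in>UNIV. \<Sum>y\<in>UNIV. if y = x + u then f x * f (x + u) * ?N else 0)"
  proof (intro sum.cong refl)
    fix x y
    have "x + y + u = 0 \<longleftrightarrow> y = x + u"
      using bit_vec_add_eq_0[of "x + u" y] by (auto simp: algebra_simps)
    then show "f x * f y * (\<Sum>S\<in>UNIV. chi S (x + y + u)) =
        (if y = x + u then f x * f (x + u) * ?N else 0)"
      by (simp add: sum_chi_UNIV)
  qed
  also have "\<dots> = ?N * (\<Sum>x\<in>UNIV. f x * f (x + u))"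
    by (simp add: sum_distrib_left mult.commute)
  finally show ?thesis by (simp add: power2_eq_square)
qed

lemma parseval_sign:
  fixes f :: "bit ^ 'n \<Rightarrow> real"
  assumes "\<And>x. f x \<in> {1, -1}"
  shows "(\<Sum>S\<in>UNIV. (fourier f S)\<^sup>2) = 1"
proof -
  have "f x * f x = 1" for x using assms[of x] by auto
  then show ?thesis using autocorrelation[of f 0] by simp
qed

text \<open>For a subspace \<open>P\<close>, the conditional expectation of \<open>f\<close> given
  the coset \<open>x + P\<close>.\<close>

definition coset_avg :: "(bit ^ 'n) set \<Rightarrow> (bit ^ 'n \<Rightarrow> real) \<Rightarrow> bit ^ 'n \<Rightarrow> real" where
  "coset_avg P f x = (\<Sum>p\<in>P. f (x + p)) / card P"

lemma coset_avg_shift: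
  assumes "vec.subspace P" "q \<in> P"
  shows "coset_avg P f (x + q) = coset_avg P f x"
  using sum_subspace_shift[OF assms, of "\<lambda>p. f (x + p)"]
  by (simp add: coset_avg_def algebra_simps)

lemma abs_coset_avg_le:
  assumes "\<And>x. \<bar>f x\<bar> \<le> 1"
  shows "\<bar>coset_avg P f x\<bar> \<le> 1"
proof -
  have "\<bar>\<Sum>p\<in>P. f (x + p)\<bar> \<le> (\<Sum>p\<in>P. 1)"
    using assms by (intro order_trans[OF sum_abs] sum_mono) auto
  then show ?thesis by (auto simp: coset_avg_def divide_le_eq_1 card_gt_0_iff)
qed

text \<open>Averaging is the orthogonal projection onto functions constant on cosets of
  \<open>P\<close>: \<open>s x\<close> may be replaced by \<open>s (x + p)\<close>, after which each
  \<open>p\<close> contributes the same sum.\<close>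

lemma sum_mult_coset_avg:
  fixes f s :: "bit ^ 'n \<Rightarrow> real"
  assumes P: "vec.subspace P" and s: "\<And>x p. p \<in> P \<Longrightarrow> s (x + p) = s x"
  shows "(\<Sum>x\<in>UNIV. coset_avg P f x * s x) = (\<Sum>x\<in>UNIV. f x * s x)"
proof -
  have "card P \<noteq> 0" using vec.subspace_0[OF P] by auto
  have "(\<Sum>x\<in>UNIV. coset_avg P f x * s x) = (\<Sum>x\<in>UNIV. \<Sum>p\<in>P. f (x + p) * s (x + p)) / card P"
    unfolding coset_avg_def sum_divide_distrib sum_distrib_right
    by (intro sum.cong refl) (simp add: s)
  also have "(\<Sum>x\<in>UNIV. \<Sum>p\<in>P. f (x + p) * s (x + p)) = (\<Sum>p\<in>P. \<Sum>x\<in>UNIV. f x * s x)"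
    by (subst sum.swap) (simp only: sum_bit_vec_shift[of "\<lambda>x. f x * s x"])
  finally show ?thesis using \<open>card P \<noteq> 0\<close> by simp
qed

text \<open>By the projection property one factor may be replaced by \<open>f\<close>. What remains
  is a sum of autocorrelations over shifts in \<open>perp A\<close>, and summing characters over
  \<open>perp A\<close> selects \<open>perp (perp A) = A\<close>.\<close>

lemma sum_coset_avg_square:
  fixes f :: "bit ^ 'n \<Rightarrow> real"
  assumes A: "vec.subspace A"
  shows "(\<Sum>x\<in>UNIV. (coset_avg (perp A) f x)\<^sup>2) = CARD(bit ^ 'n) * fourier_weight f A"
proof -
  let ?P = "perp A" and ?N = "real CARD(bit ^ 'n)"
  note P = subspace_perp[of A]
  have "card ?P \<noteq> 0" using vec.subspace_0[OF P] by auto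
  have "(\<Sum>x\<in>UNIV. (coset_avg ?P f x)\<^sup>2) = (\<Sum>x\<in>UNIV. f x * coset_avg ?P f x)"
    unfolding power2_eq_square by (rule sum_mult_coset_avg[OF P]) (rule coset_avg_shift[OF P])
  also have "\<dots> = (\<Sum>p\<in>?P. \<Sum>x\<in>UNIV. f x * f (x + p)) / card ?P"
    by (subst sum.swap) (simp add: coset_avg_def sum_divide_distrib sum_distrib_left)
  also have "(\<Sum>p\<in>?P. \<Sum>x\<in>UNIV. f x * f (x + p)) =
      ?N * (\<Sum>S\<in>UNIV. (fourier f S)\<^sup>2 * (\<Sum>p\<in>?P. chi p S))"
    unfolding autocorrelation sum_distrib_left
    by (subst sum.swap) (simp add: chi_commute)
  also have "(\<Sum>S\<in>UNIV. (fourier f S)\<^sup>2 * (\<Sum>p\<in>?P. chi p S)) = fourier_weight f A * card ?P"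
    unfolding sum_chi_subspace[OF P] perp_perp[OF A] fourier_weight_def sum_distrib_right
    by (rule sum.mono_neutral_cong_right) auto
  finally show ?thesis using \<open>card ?P \<noteq> 0\<close> by simp
qed

text \<open>For signs the indicator of agreement is \<open>(1 + f x * g x) / 2\<close>; this turns
  success probabilities into correlations.\<close>

lemma prob_agree:
  fixes f g :: "bit ^ 'n \<Rightarrow> real"
  assumes "\<And>x. f x \<in> {1, -1}" "\<And>x. g x \<in> {1, -1}"
  shows "measure_pmf.prob (pmf_of_set UNIV) {x. g x = f x} =
    (1 + (\<Sum>x\<in>UNIV. f x * g x) / CARD(bit ^ 'n)) / 2"
proof -
  have "real (card {x. g x = f x}) = (\<Sum>x\<in>UNIV. if g x = f x then 1 else 0)"
    by (simp add: sum.If_cases)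
  also have "\<dots> = (\<Sum>x\<in>UNIV. (1 + f x * g x) / 2)"
  proof (rule sum.cong[OF refl])
    fix x show "(if g x = f x then 1 else 0) = (1 + f x * g x) / 2"
      using assms[of x] by auto
  qed
  also have "\<dots> = (CARD(bit ^ 'n) + (\<Sum>x\<in>UNIV. f x * g x)) / 2"
    by (simp add: sum.distrib flip: sum_divide_distrib)
  finally show ?thesis by (simp add: measure_pmf_of_set field_simps)
qed

section \<open>Linear sketches\<close>

text \<open>The first player sends the parities of \<open>x\<close>; the second adds those of
  \<open>y\<close> and, by linearity, evaluates the sketch at \<open>x + y\<close>.\<close>

lemma D_oneway_plus_fun_le_D_lin:
  fixes f :: "bit ^ 'n \<Rightarrow> real"
  shows "D_oneway \<delta> (plus_fun f) \<le> D_lin \<delta> f"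
  unfolding D_oneway_def D_lin_def
proof (intro Inf_superset_mono subsetI, clarify)
  fix \<alpha> :: "(bit ^ 'n) list" and g :: "bit list \<Rightarrow> real"
  assume g: "\<forall>z. length z = length \<alpha> \<longrightarrow> g z \<in> {1, -1}"
    and pr: "1 - \<delta> \<le> measure_pmf.prob (pmf_of_set UNIV) {x. g (map (\<lambda>a. dotp a x) \<alpha>) = f x}"
  define M where "M x = map (\<lambda>a. dotp a x = 1) \<alpha>" for x :: "bit ^ 'n"
  define h where "h m y = g (map2 (\<lambda>b a. of_bool b + dotp a y) m \<alpha>)"
    for m :: "bool list" and y :: "bit ^ 'n"
  have "of_bool (b = 1) = b" for b :: bit by (cases b) auto
  then have "map2 (\<lambda>b a. of_bool b + dotp a y) (map (\<lambda>a. dotp a x = 1) as) as =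
      map (\<lambda>a. dotp a (x + y)) as" for as and x y :: "bit ^ 'n"
    by (induction as) (auto simp: dotp_add_right)
  then have hM: "h (M x) y = g (map (\<lambda>a. dotp a (x + y)) \<alpha>)" for x y
    by (simp add: h_def M_def)
  let ?Q = "\<lambda>x. g (map (\<lambda>a. dotp a x) \<alpha>) = f x"
  \<comment> \<open>The involution sending \<open>(x, y)\<close> to \<open>(x, x + y)\<close> shows
    that \<open>x + y\<close> is uniform.\<close>
  have "card {(x, y). ?Q (x + y)} = card ((UNIV :: (bit ^ 'n) set) \<times> Collect ?Q)"
    by (rule bij_betw_same_card[where f = "\<lambda>(x, y :: bit ^ 'n). (x, x + y)"],
        rule bij_betwI[where g = "\<lambda>(x, y :: bit ^ 'n). (x, x + y)"]) auto
  then have "measure_pmf.prob (pmf_of_set UNIV) {(x, y). ?Q (x + y)} =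
      measure_pmf.prob (pmf_of_set UNIV) (Collect ?Q)"
    by (simp add: measure_pmf_of_set card_cartesian_product)
  then have "1 - \<delta> \<le> measure_pmf.prob (pmf_of_set UNIV) {(x, y). h (M x) y = plus_fun f x y}"
    using pr by (simp add: hM plus_fun_def)
  moreover have "\<forall>x. length (M x) = length \<alpha>" by (simp add: M_def)
  moreover have "\<forall>m y. length m = length \<alpha> \<longrightarrow> h m y \<in> {1, -1}" using g by (simp add: h_def)
  ultimately show "\<exists>t. enat (length \<alpha>) = enat t \<and> (\<exists>(M :: bit ^ 'n \<Rightarrow> bool list) h.
      (\<forall>x. length (M x) = t) \<and>
      (\<forall>m y. length m = t \<longrightarrow> h m y \<in> {1, -1}) \<and>
      1 - \<delta> \<le> measure_pmf.prob (pmf_of_set UNIV) {(x, y). h (M x) y = plus_fun f x y})"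
    by (intro exI[of _ "length \<alpha>"] exI[of _ M] exI[of _ h] conjI refl)
qed

text \<open>The parities of a spanning set of size \<open>dim A\<close> determine the coset of
  \<open>perp A\<close>, hence the sign \<open>s\<close> of the average \<open>?F\<close>. The
  correlation of \<open>s\<close> with \<open>f\<close> is the mean of
  \<open>\<bar>?F\<bar>\<close>, which dominates that of its square because
  \<open>\<bar>?F\<bar>\<close> is at most 1.\<close>

lemma D_lin_le_dim:
  fixes f :: "bit ^ 'n \<Rightarrow> real"
  assumes f: "\<And>x. f x \<in> {1, -1}" and A: "vec.subspace A"
  shows "D_lin ((1 - fourier_weight f A) / 2) f \<le> enat (vec.dim A)"
proof -
  let ?N = "real CARD(bit ^ 'n)"
  obtain B where B: "B \<subseteq> A" "A \<subseteq> vec.span B" "card B = vec.dim A"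
    by (rule vec.basis_exists)
  obtain \<alpha> where \<alpha>: "set \<alpha> = B" "distinct \<alpha>"
    using finite_distinct_list[of B] by auto
  have "vec.span B = A"
    using B vec.span_minimal[OF _ A] by blast
  then have perp_eq: "perp A = perp (set \<alpha>)" by (metis \<alpha>(1) perp_span)
  let ?F = "coset_avg (perp A) f" and ?z = "\<lambda>x. map (\<lambda>a. dotp a x) \<alpha>"
  define s :: "bit ^ 'n \<Rightarrow> real" where "s x = (if ?F x \<ge> 0 then 1 else -1)" for x
  have F_cong: "?F x = ?F y" if "?z x = ?z y" for x y
  proof -
    have "x + y \<in> perp A"
      using that unfolding perp_eq by (auto simp: perp_def dotp_add_right bit_add_self)
    from coset_avg_shift[OF subspace_perp this, of f y] show ?thesis
      by (simp only: add.left_commute[of y x y] bit_vec_add_self add_0_right)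
  qed
  \<comment> \<open>By \<open>F_cong\<close> any representative with parities \<open>z\<close> gives
    the same sign; a \<open>z\<close> that is not attained still gets a legal output.\<close>
  define g where "g z = s (SOME x. ?z x = z)" for z
  have g: "g (?z x) = s x" for x
    using F_cong[OF someI[of "\<lambda>y. ?z y = ?z x", OF refl]] by (simp only: g_def s_def)
  have s: "s x \<in> {1, -1}" for x by (simp add: s_def)
  have "?N * fourier_weight f A = (\<Sum>x\<in>UNIV. (?F x)\<^sup>2)"
    by (rule sum_coset_avg_square[OF A, symmetric])
  also have "\<dots> \<le> (\<Sum>x\<in>UNIV. ?F x * s x)"
  proof (rule sum_mono)
    fix x
    have "\<bar>?F x\<bar> \<le> 1"
      by (rule abs_coset_avg_le) (metis f abs_1 abs_minus_cancel insertE order_refl singletonD)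
    then have "\<bar>?F x\<bar> * \<bar>?F x\<bar> \<le> \<bar>?F x\<bar> * 1" by (intro mult_left_mono) auto
    then show "(?F x)\<^sup>2 \<le> ?F x * s x"
      by (auto simp: s_def power2_eq_square)
  qed
  also have "\<dots> = (\<Sum>x\<in>UNIV. f x * s x)"
    by (rule sum_mult_coset_avg[OF subspace_perp])
      (simp add: s_def coset_avg_shift[OF subspace_perp])
  finally have "fourier_weight f A \<le> (\<Sum>x\<in>UNIV. f x * s x) / ?N"
    by (simp add: pos_le_divide_eq mult.commute)
  then have "measure_pmf.prob (pmf_of_set UNIV) {x. g (?z x) = f x} \<ge>
      1 - (1 - fourier_weight f A) / 2"
    by (simp add: g prob_agree[OF f s] field_simps)
  moreover have "length \<alpha> = vec.dim A"
    using \<alpha> B by (simp flip: distinct_card)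
  moreover have "\<forall>z. length z = vec.dim A \<longrightarrow> g z \<in> {1, -1}"
    using s by (simp add: g_def)
  ultimately show ?thesis
    unfolding D_lin_def by (intro Inf_lower) blast
qed

text \<open>The sketch is constant on cosets of \<open>?P\<close>, so it correlates with
  \<open>f\<close> exactly as with the coset average; Cauchy-Schwarz bounds this by the norm of that
  average.\<close>

lemma prob_linear_sketch_le:
  fixes f :: "bit ^ 'n \<Rightarrow> real"
  assumes f: "\<And>x. f x \<in> {1, -1}"
    and g: "\<And>z. length z = length \<alpha> \<Longrightarrow> g z \<in> {1, -1}"
  shows "measure_pmf.prob (pmf_of_set UNIV) {x. g (map (\<lambda>a. dotp a x) \<alpha>) = f x} \<le>
    (1 + sqrt (fourier_weight f (vec.span (set \<alpha>)))) / 2"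
proof -
  let ?N = "real CARD(bit ^ 'n)" and ?A = "vec.span (set \<alpha>)"
  let ?P = "perp ?A"
  define G where "G x = g (map (\<lambda>a. dotp a x) \<alpha>)" for x
  have G: "G x \<in> {1, -1}" for x using g by (simp add: G_def)
  have G_shift: "G (x + p) = G x" if "p \<in> ?P" for x p
  proof -
    have "map (\<lambda>a. dotp a (x + p)) \<alpha> = map (\<lambda>a. dotp a x) \<alpha>"
      using that by (auto simp: perp_span) (simp add: perp_def dotp_add_right)
    then show ?thesis by (simp only: G_def)
  qed
  have "(\<Sum>x\<in>UNIV. f x * G x)\<^sup>2 = (\<Sum>x\<in>UNIV. coset_avg ?P f x * G x)\<^sup>2"
    using sum_mult_coset_avg[OF subspace_perp, of ?A G f] G_shift by simp
  also have "\<dots> \<le> (\<Sum>x\<in>UNIV. (coset_avg ?P f x)\<^sup>2) * (\<Sum>x\<in>UNIV. (G x)\<^sup>2)"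
    by (rule Cauchy_Schwarz_ineq_sum)
  also have "(\<Sum>x\<in>UNIV. (G x)\<^sup>2) = (\<Sum>x\<in>(UNIV :: (bit ^ 'n) set). 1)"
    by (rule sum.cong) (use G in \<open>auto simp: power2_eq_1_iff\<close>)
  also have "(\<Sum>x\<in>UNIV. (coset_avg ?P f x)\<^sup>2) = ?N * fourier_weight f ?A"
    by (rule sum_coset_avg_square) (rule vec.subspace_span)
  finally have "(\<Sum>x\<in>UNIV. f x * G x)\<^sup>2 \<le> ?N\<^sup>2 * fourier_weight f ?A"
    by (simp add: power2_eq_square[of ?N] mult_ac)
  then have "(\<Sum>x\<in>UNIV. f x * G x) \<le> ?N * sqrt (fourier_weight f ?A)"
    using real_le_rsqrt by (fastforce simp: real_sqrt_mult)
  then have "(\<Sum>x\<in>UNIV. f x * G x) / ?N \<le> sqrt (fourier_weight f ?A)"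
    by (simp add: pos_divide_le_eq mult.commute)
  then show ?thesis
    using prob_agree[of f G] f G by (simp add: G_def)
qed

text \<open>At most \<open>d\<close> parities span a space that extends to dimension exactly
  \<open>d\<close>, so its weight is at most \<open>eps_dim d f\<close>.\<close>

lemma D_lin_gt_dim:
  fixes f :: "bit ^ 'n \<Rightarrow> real"
  assumes f: "\<And>x. f x \<in> {1, -1}" and d: "d \<le> CARD('n)"
    and \<gamma>: "\<gamma> < (1 - sqrt (eps_dim d f)) / 2"
  shows "enat (d + 1) \<le> D_lin \<gamma> f"
  unfolding D_lin_def
proof (rule Inf_greatest, clarify)
  fix \<alpha> :: "(bit ^ 'n) list" and g :: "bit list \<Rightarrow> real"
  assume g: "\<forall>z. length z = length \<alpha> \<longrightarrow> g z \<in> {1, -1}"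
    and pr: "1 - \<gamma> \<le> measure_pmf.prob (pmf_of_set UNIV) {x. g (map (\<lambda>a. dotp a x) \<alpha>) = f x}"
  show "enat (d + 1) \<le> enat (length \<alpha>)"
  proof (rule ccontr)
    assume "\<not> enat (d + 1) \<le> enat (length \<alpha>)"
    then have "length \<alpha> \<le> d" by simp
    moreover have "vec.dim (vec.span (set \<alpha>)) \<le> length \<alpha>"
      using vec.dim_le_card'[of "set \<alpha>"] card_length[of \<alpha>] by simp
    ultimately obtain B where B: "vec.span (set \<alpha>) \<subseteq> B" "vec.subspace B" "vec.dim B = d"
      using subspace_extend[OF vec.subspace_span _ d, of "set \<alpha>"] by auto
    then have "fourier_weight f (vec.span (set \<alpha>)) \<le> eps_dim d f"
      using fourier_weight_mono[OF B(1), of f] fourier_weight_le_eps_dim[OF B(2,3), of f] by linarith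
    then have "sqrt (fourier_weight f (vec.span (set \<alpha>))) \<le> sqrt (eps_dim d f)" by simp
    moreover have "measure_pmf.prob (pmf_of_set UNIV) {x. g (map (\<lambda>a. dotp a x) \<alpha>) = f x} \<le>
        (1 + sqrt (fourier_weight f (vec.span (set \<alpha>)))) / 2"
      using f g by (intro prob_linear_sketch_le) auto
    ultimately show False
      using pr \<gamma> by argo
  qed
qed

section \<open>One-way protocols\<close>

text \<open>The fraction of disagreements is the Fourier weight of all \<open>S\<close> with
  \<open>dotp S (x + x') = 1\<close>. Keeping only those in \<open>A\<close> leaves \<open>A\<close>
  minus a subspace of dimension \<open>dim A - 1\<close>.\<close>

lemma card_translates_differ_ge:
  fixes f :: "bit ^ 'n \<Rightarrow> real"
  assumes f: "\<And>x. f x \<in> {1, -1}" and A: "vec.subspace A" and u: "x + x' \<notin> perp A"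
  shows "CARD(bit ^ 'n) * (fourier_weight f A - eps_dim (vec.dim A - 1) f)
    \<le> card {y. f (x + y) \<noteq> f (x' + y)}"
proof -
  let ?N = "real CARD(bit ^ 'n)" and ?w = "\<lambda>S. (fourier f S)\<^sup>2"
  let ?u = "x + x'"
  let ?H = "{S \<in> A. dotp S ?u = 0}"
  have "fourier_weight f A - fourier_weight f ?H = (\<Sum>S\<in>A - ?H. ?w S)"
    unfolding fourier_weight_def by (subst sum_diff) auto
  also have "\<dots> = (\<Sum>S\<in>A - ?H. ?w S * ((1 - chi S ?u) / 2))"
    by (rule sum.cong) (auto simp: chi_def)
  also have "\<dots> \<le> (\<Sum>S\<in>UNIV. ?w S * ((1 - chi S ?u) / 2))"
    by (rule sum_mono2) (auto simp: chi_def)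
  also have "\<dots> = (1 - (\<Sum>S\<in>UNIV. ?w S * chi S ?u)) / 2"
    using parseval_sign[OF f]
    by (simp add: right_diff_distrib sum_subtractf flip: sum_divide_distrib)
  finally have "fourier_weight f A - fourier_weight f ?H \<le> (1 - (\<Sum>S\<in>UNIV. ?w S * chi S ?u)) / 2" .
  moreover have "fourier_weight f ?H \<le> eps_dim (vec.dim A - 1) f"
    using dim_hyperplane_section[OF A u] by (rule fourier_weight_le_eps_dim)
  ultimately have "?N * (fourier_weight f A - eps_dim (vec.dim A - 1) f) \<le>
      ?N * ((1 - (\<Sum>S\<in>UNIV. ?w S * chi S ?u)) / 2)"
    by (intro mult_left_mono) auto
  also have "\<dots> = (?N - (\<Sum>y\<in>UNIV. f y * f (y + ?u))) / 2"
    by (simp add: autocorrelation algebra_simps)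
  also have "(\<Sum>y\<in>UNIV. f y * f (y + ?u)) = (\<Sum>y\<in>UNIV. f (x + y) * f (x' + y))"
    using sum_bit_vec_shift[of "\<lambda>y. f y * f (y + ?u)" x] by (simp add: algebra_simps)
  also have "(?N - \<dots>) / 2 = (\<Sum>y\<in>UNIV. (1 - f (x + y) * f (x' + y)) / 2)"
    by (simp add: sum_subtractf flip: sum_divide_distrib)
  also have "\<dots> = (\<Sum>y\<in>UNIV. if f (x + y) \<noteq> f (x' + y) then 1 else 0)"
  proof (rule sum.cong[OF refl])
    fix y show "(1 - f (x + y) * f (x' + y)) / 2 = (if f (x + y) \<noteq> f (x' + y) then 1 else 0)"
      using f[of "x + y"] f[of "x' + y"] by auto
  qed
  also have "\<dots> = card {y. f (x + y) \<noteq> f (x' + y)}"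
    by (simp add: sum.If_cases)
  finally show ?thesis .
qed

text \<open>Sums \<open>e x + e y\<close> over ordered pairs of one message class \<open>C\<close>:
  at least \<open>card C - p\<close> partners of each \<open>x\<close> are far and cost
  \<open>D\<close>. The term \<open>sum e C / N\<close> comes from the diagonal.\<close>

lemma sum_errors_class_ge:
  fixes e :: "'a \<Rightarrow> real" and N D p :: real
  assumes C: "finite C" "real (card C) \<le> N" and D: "0 \<le> D" and p: "0 \<le> p"
    and e: "\<And>x. x \<in> C \<Longrightarrow> 0 \<le> e x"
    and far: "\<And>x y. x \<in> C \<Longrightarrow> y \<in> C \<Longrightarrow> \<not> R x y \<Longrightarrow> D \<le> e x + e y"
    and refl: "\<And>x. x \<in> C \<Longrightarrow> R x x"
    and near: "\<And>x. x \<in> C \<Longrightarrow> real (card {y \<in> C. R x y}) \<le> p"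
  shows "D / 2 * (card C - p) + sum e C / N \<le> sum e C"
proof (cases "C = {}")
  case True
  then show ?thesis using D p by simp
next
  case False
  let ?c = "real (card C)"
  have c: "0 < ?c" using False C by (simp add: card_gt_0_iff)
  \<comment> \<open>By reflexivity of \<open>R\<close> the pair \<open>(x, x)\<close> is charged no
    \<open>D\<close>, so its contribution \<open>2 * e x\<close> can be added.\<close>
  have point: "D * (?c - p) + 2 * e x \<le> (\<Sum>y\<in>C. e x + e y)" if x: "x \<in> C" for x
  proof -
    have "?c - p \<le> ?c - real (card {y \<in> C. R x y})" using near[OF x] by simp
    also have "\<dots> = (\<Sum>y\<in>C. 1 - (if R x y then 1 else 0))"
      using sum.inter_filter[OF C(1), of "\<lambda>_. 1 :: real" "R x"] by (simp add: sum_subtractf)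
    also have "\<dots> = (\<Sum>y\<in>C. if R x y then 0 else 1)"
      by (rule sum.cong) auto
    finally have "D * (?c - p) \<le> D * (\<Sum>y\<in>C. if R x y then 0 else 1)"
      by (rule mult_left_mono) (rule D)
    moreover have "D * (\<Sum>y\<in>C. if R x y then 0 else 1) + 2 * e x =
        (\<Sum>y\<in>C. D * (if R x y then 0 else 1) + (if y = x then 2 * e x else 0))"
      using C x by (simp add: sum.distrib sum_distrib_left)
    moreover have "\<dots> \<le> (\<Sum>y\<in>C. e x + e y)"
      using x e far refl by (intro sum_mono) auto
    ultimately show ?thesis by linarith
  qed
  have "?c * (D * (?c - p)) + 2 * sum e C = (\<Sum>x\<in>C. D * (?c - p) + 2 * e x)"
    by (simp add: sum.distrib sum_distrib_left)
  also have "\<dots> \<le> (\<Sum>x\<in>C. \<Sum>y\<in>C. e x + e y)"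
    by (rule sum_mono) (rule point)
  also have "\<dots> = 2 * ?c * sum e C"
    by (simp add: sum.distrib flip: sum_distrib_left)
  finally have "D / 2 * (?c - p) + sum e C / ?c \<le> sum e C"
    using c by (simp add: field_simps)
  \<comment> \<open>Weakening the denominator from the class size to the common \<open>N\<close>
    lets the diagonal terms be added across classes.\<close>
  moreover have "sum e C / N \<le> sum e C / ?c"
    using c C(2) sum_nonneg[of C e] e by (intro divide_left_mono) auto
  ultimately show ?thesis by linarith
qed

lemma D_oneway_plus_fun_ge:
  fixes f :: "bit ^ 'n \<Rightarrow> real"
  assumes f: "\<And>x. f x \<in> {1, -1}" and d: "1 \<le> d" "d \<le> CARD('n)" and gap: "0 < dim_gap d f"
  shows "enat d \<le> D_oneway (dim_gap d f / 4) (plus_fun f)"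
  unfolding D_oneway_def
proof (rule Inf_greatest, clarify)
  fix t and M :: "bit ^ 'n \<Rightarrow> bool list" and h :: "bool list \<Rightarrow> bit ^ 'n \<Rightarrow> real"
  assume M: "\<forall>x. length (M x) = t"
    and pr: "1 - dim_gap d f / 4 \<le>
      measure_pmf.prob (pmf_of_set UNIV) {(x, y). h (M x) y = plus_fun f x y}"
  let ?N = "real CARD(bit ^ 'n)" and ?\<Delta> = "dim_gap d f"
  obtain A where A: "vec.subspace A" "vec.dim A = d" "fourier_weight f A = eps_dim d f"
    by (rule eps_dim_attained[OF d(2)])
  let ?p = "card (perp A)"
  define err where "err x = real (card {y. h (M x) y \<noteq> f (x + y)})" for x
  have far: "?N * ?\<Delta> \<le> err x + err x'" if "M x = M x'" "x + x' \<notin> perp A" for x x'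
  proof -
    have "?N * ?\<Delta> \<le> card {y. f (x + y) \<noteq> f (x' + y)}"
      using card_translates_differ_ge[of f A x x'] f A that(2) by (simp add: dim_gap_def)
    \<comment> \<open>Where the translates differ, the common answer is wrong for at least one of
      the two inputs.\<close>
    also have "\<dots> \<le> real (card ({y. h (M x) y \<noteq> f (x + y)} \<union> {y. h (M x') y \<noteq> f (x' + y)}))"
      using that(1) by (intro of_nat_mono card_mono) auto
    also have "\<dots> \<le> err x + err x'"
      unfolding err_def of_nat_add[symmetric] by (intro of_nat_mono card_Un_le)
    finally show ?thesis .
  qed
  let ?C = "\<lambda>m. {x. M x = m}" and ?T = "{m :: bool list. length m = t}"
  have fin_T: "finite ?T" and card_T: "card ?T = 2 ^ t"
    using finite_lists_length_eq[of "UNIV :: bool set" t]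
      card_lists_length_eq[of "UNIV :: bool set" t] by auto
  have group: "(\<Sum>m\<in>?T. sum k (?C m)) = sum k UNIV" for k :: "bit ^ 'n \<Rightarrow> real"
    using sum.group[of UNIV ?T M k] fin_T M by auto
  \<comment> \<open>Translation by \<open>x\<close> maps these \<open>y\<close> injectively into
    \<open>perp A\<close>.\<close>
  have near: "real (card {y \<in> ?C m. x + y \<in> perp A}) \<le> ?p" for x m
    by (intro of_nat_mono card_inj_on_le[where f = "(+) x"]) auto
  have per_class: "?N * ?\<Delta> / 2 * (real (card (?C m)) - real ?p) + sum err (?C m) / ?N
      \<le> sum err (?C m)" for m
  proof (rule sum_errors_class_ge[where R = "\<lambda>x y. x + y \<in> perp A"])
    show "?N * ?\<Delta> \<le> err x + err y" if "x \<in> ?C m" "y \<in> ?C m" "x + y \<notin> perp A" for x y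
      using that by (intro far) auto
  qed (use gap near vec.subspace_0[OF subspace_perp[of A]] in \<open>auto simp: err_def intro: card_mono\<close>)
  have "(\<Sum>m\<in>?T. ?N * ?\<Delta> / 2 * (real (card (?C m)) - real ?p) + sum err (?C m) / ?N) \<le>
      (\<Sum>m\<in>?T. sum err (?C m))"
    by (rule sum_mono) (rule per_class)
  moreover have "(\<Sum>m\<in>?T. real (card (?C m))) = ?N"
    using group[of "\<lambda>_. 1"] by simp
  \<comment> \<open>The class sizes add up to \<open>?N\<close>, and each of the
    \<open>2 ^ t\<close> messages, attained or not, subtracts \<open>?p\<close>.\<close>
  ultimately have total: "?N * ?\<Delta> / 2 * (?N - 2 ^ t * ?p) + sum err UNIV / ?N \<le> sum err UNIV"
    by (simp add: sum.distrib group sum_subtractf card_T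
        flip: sum_divide_distrib sum_distrib_left)
  have "card {(x, y). h (M x) y = f (x + y)} + card {(x, y). h (M x) y \<noteq> f (x + y)} =
      card (UNIV :: ((bit ^ 'n) \<times> (bit ^ 'n)) set)"
    by (subst card_Un_disjoint[symmetric]) (auto simp del: card_prod intro!: arg_cong[where f = card])
  moreover have "{(x, y). h (M x) y \<noteq> f (x + y)} = (SIGMA x:UNIV. {y. h (M x) y \<noteq> f (x + y)})"
    by auto
  then have "real (card {(x, y). h (M x) y \<noteq> f (x + y)}) = sum err UNIV"
    by (simp add: err_def)
  ultimately have "real (card {(x, y). h (M x) y = f (x + y)}) = ?N * ?N - sum err UNIV"
    by (simp flip: of_nat_mult of_nat_add)
  then have "1 - ?\<Delta> / 4 \<le> (?N * ?N - sum err UNIV) / (?N * ?N)"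
    using pr by (simp add: plus_fun_def measure_pmf_of_set)
  then have err_le: "sum err UNIV \<le> ?\<Delta> / 4 * (?N * ?N)"
    by (simp add: field_simps)
  show "enat d \<le> enat t"
  proof (rule ccontr)
    assume "\<not> enat d \<le> enat t"
    then have "t \<le> d - 1" by simp
    then have "(2 :: real) ^ t \<le> 2 ^ (d - 1)" by (intro power_increasing) auto
    \<comment> \<open>Fewer than \<open>d\<close> bits thus cover, at \<open>?p\<close> inputs per
      message, at most half of all inputs.\<close>
    moreover have "2 ^ d * real ?p = ?N"
      unfolding card_mult_card_perp[OF A(1), symmetric] card_subspace[OF A(1)] A(2) by simp
    then have "2 ^ (d - 1) * real ?p = ?N / 2"
      using d(1) by (cases d) auto
    ultimately have "2 ^ t * real ?p \<le> ?N / 2"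
      using mult_right_mono[of "(2 :: real) ^ t" "2 ^ (d - 1)" ?p] by simp
    then have "?N * ?\<Delta> / 2 * (?N / 2) \<le> ?N * ?\<Delta> / 2 * (?N - 2 ^ t * ?p)"
      using gap by (intro mult_left_mono) auto
    moreover have "?N * ?\<Delta> / 2 * (?N / 2) = ?\<Delta> / 4 * (?N * ?N)" by simp
    ultimately have ge: "?\<Delta> / 4 * (?N * ?N) + sum err UNIV / ?N \<le> sum err UNIV"
      using total by linarith
    have "sum err UNIV \<ge> 0" by (simp add: err_def sum_nonneg)
    moreover have "0 < ?\<Delta> / 4 * (?N * ?N)" using gap by simp
    \<comment> \<open>The main term only reaches the allowed error \<open>?\<Delta> / 4\<close>; the
      diagonal term, now positive, exceeds it.\<close>
    ultimately have "0 < sum err UNIV" using ge by (smt (verit) divide_nonneg_nonneg of_nat_0_le_iff)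
    then have "0 < sum err UNIV / ?N" by simp
    then show False using ge err_le by linarith
  qed
qed

theorem theorem3p4:
  fixes f :: "bit ^ 'n \<Rightarrow> real" and d :: nat and \<epsilon>\<^sub>1 \<delta> :: real
  assumes "\<And>x. f x \<in> {1, -1}"
    and "1 \<le> d" and "d \<le> CARD('n)"
    and "\<epsilon>\<^sub>1 = eps_dim d f"
    and "\<delta> = dim_gap d f / 4"
  shows "(D_oneway ((1 - \<epsilon>\<^sub>1) / 2) (plus_fun f) \<le> D_lin ((1 - \<epsilon>\<^sub>1) / 2) f
            \<and> D_lin ((1 - \<epsilon>\<^sub>1) / 2) f \<le> enat d)
       \<and> (\<forall>\<gamma> < (1 - sqrt \<epsilon>\<^sub>1) / 2. D_lin \<gamma> f \<ge> enat (d + 1))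
       \<and> ((\<exists>\<epsilon>. approx_dim \<epsilon> f = enat d) \<longrightarrow> D_oneway \<delta> (plus_fun f) \<ge> enat d)"
proof (intro conjI allI impI)
  show "D_oneway ((1 - \<epsilon>\<^sub>1) / 2) (plus_fun f) \<le> D_lin ((1 - \<epsilon>\<^sub>1) / 2) f"
    by (rule D_oneway_plus_fun_le_D_lin)
  obtain A where "vec.subspace A" "vec.dim A = d" "fourier_weight f A = eps_dim d f"
    by (rule eps_dim_attained[OF assms(3)])
  then show "D_lin ((1 - \<epsilon>\<^sub>1) / 2) f \<le> enat d"
    using D_lin_le_dim[of f A, OF assms(1)] assms(4) by simp
  show "enat (d + 1) \<le> D_lin \<gamma> f" if "\<gamma> < (1 - sqrt \<epsilon>\<^sub>1) / 2" for \<gamma>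
    using D_lin_gt_dim[OF assms(1,3)] that assms(4) by simp
  \<comment> \<open>The premise is equivalent to a positive gap, the form in which the lower bound
    uses it.\<close>
  show "enat d \<le> D_oneway \<delta> (plus_fun f)" if "\<exists>\<epsilon>. approx_dim \<epsilon> f = enat d"
    unfolding assms(5) using assms(1-3) that approx_dim_exists_iff[OF assms(2,3), of f]
    by (intro D_oneway_plus_fun_ge) auto
qed

end
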